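(* The rectangular simplex $\Delta(2,5,7,11,619)\subset\mathbb{R}^5$ has maximal normality index, i.e. $\mu_{norm}(\Delta(2,5,7,11,619)) = 4$.
   Context: For $\lambda\in\mathbb{Z}_+^n$ (positive integer entries), the rectangular simplex $\Delta(\lambda) \subset \mathbb{R}^n$ is the convex hull of $\{0,\lambda_1 e_1,\dots,\lambda_n e_n\}$. A lattice polytope $Q \subset \mathbb{R}^n$ is normal if for every integer $k \ge 1$ every $x \in kQ \cap \mathbb{Z}^n$ is a sum of $k$ points of $Q\cap\mathbb{Z}^n$. The normality index is $\mu_{norm}(Q) = \min\{k_0 \ge 1 : kQ \text{ is normal for all } k \ge k_0\}$. It is called maximal for an $n$-dimensional rectangular simplex when it equals $n-1$. *)

theory Defs
  imports "HOL-Analysis.Analysis"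
begin

definition lattice_points :: "(real ^ 'n) set" where
  "lattice_points = {x. \<forall>i. x $ i \<in> \<int>}"

definition lattice_polytope :: "(real ^ 'n) set \<Rightarrow> bool" where
  "lattice_polytope Q \<longleftrightarrow> (\<exists>V. finite V \<and> V \<subseteq> lattice_points \<and> Q = convex hull V)"

definition dilate :: "nat \<Rightarrow> (real ^ 'n) set \<Rightarrow> (real ^ 'n) set" where
  "dilate k Q = (\<lambda>x. real k *\<^sub>R x) ` Q"

definition normal_polytope :: "(real ^ 'n) set \<Rightarrow> bool" where
  "normal_polytope Q \<longleftrightarrow> lattice_polytope Q \<and>
     (\<forall>k\<ge>1. \<forall>x \<in> dilate k Q \<inter> lattice_points.
        \<exists>q :: nat \<Rightarrow> real ^ 'n. (\<forall>j<k. q j \<in> Q \<inter> lattice_points) \<and> x = (\<Sum>j<k. q j))"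

definition normality_index :: "(real ^ 'n) set \<Rightarrow> nat" where
  "normality_index Q = (LEAST k0. 1 \<le> k0 \<and> (\<forall>k\<ge>k0. normal_polytope (dilate k Q)))"

definition rect_simplex :: "nat ^ 'n \<Rightarrow> (real ^ 'n) set" where
  "rect_simplex l = convex hull (insert 0 (range (\<lambda>i. real (l $ i) *\<^sub>R axis i 1)))"

definition maximal_normality_index :: "nat ^ 'n \<Rightarrow> bool" where
  "maximal_normality_index l \<longleftrightarrow>
     (\<forall>i. 0 < l $ i) \<and> normality_index (rect_simplex l) = CARD('n) - 1"

(* In the index type 5 the numeral 5 denotes 0, so the last entry sits at index 5 = 0. *)
lemma vector_5 [simp]:
  "(vector [a, b, c, d, e] :: ('a::zero) ^ 5) $ 1 = a"
  "(vector [a, b, c, d, e] :: ('a::zero) ^ 5) $ 2 = b"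
  "(vector [a, b, c, d, e] :: ('a::zero) ^ 5) $ 3 = c"
  "(vector [a, b, c, d, e] :: ('a::zero) ^ 5) $ 4 = d"
  "(vector [a, b, c, d, e] :: ('a::zero) ^ 5) $ 5 = e"
  unfolding vector_def by simp_all

end

theory Submission
  imports Defs
begin

text \<open>Give a vector \<open>x\<close> the weight \<Sum> \<open>x $ i / real (l $ i)\<close>.
  For k > 0 the k-th dilate consists of the nonnegative vectors of weight at most k, so normality
  asks for splitting vectors of naturals into summands of bounded weight. If k \<ge> n - 1, such
  summands can be peeled off greedily (\<open>split_off_summand\<close>,
  \<open>decompose_into_summands\<close>), so the k-th dilate is normal; for n = 5 the index is at
  most 4. The third dilate is not normal. Weights of lattice points are multiples of 1 / 476630, and
  (5, 4, 6, 10, 578) has weight just one such unit below 6. Splitting it into two summands of weight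
  at most 3 forces one to have weight exactly 3, which congruences modulo 5, 7, 11 and 619 exclude
  (\<open>no_weight_3\<close>).\<close>

section \<open>Dilates of the simplex described by weight\<close>

text \<open>The diagonal linear map \<open>f\<close> carries the standard simplex onto
  \<open>rect_simplex l\<close>, since linear images commute with convex hulls.\<close>

lemma mem_rect_simplex_iff:
  fixes l :: "nat ^ 'n"
  assumes l: "\<And>i. 0 < l $ i"
  shows "x \<in> rect_simplex l \<longleftrightarrow> (\<forall>i. 0 \<le> x $ i) \<and> (\<Sum>i\<in>UNIV. x $ i / real (l $ i)) \<le> 1"
proof -
  define f :: "real ^ 'n \<Rightarrow> real ^ 'n" where "f = (\<lambda>x. \<chi> i. real (l $ i) * x $ i)"
  have lin: "linear f"
    unfolding f_def by (rule linearI) (auto simp: vec_eq_iff algebra_simps)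
  have Basis: "(Basis :: (real ^ 'n) set) = range (\<lambda>i. axis i 1)"
    by (auto simp: Basis_vec_def)
  have "f (axis i 1) = real (l $ i) *\<^sub>R axis i 1" for i
    by (auto simp: f_def vec_eq_iff axis_def)
  moreover have "f 0 = 0"
    using lin by (rule linear_0)
  ultimately have "insert 0 (range (\<lambda>i. real (l $ i) *\<^sub>R axis i 1)) = f ` insert 0 Basis"
    by (simp add: Basis image_image)
  then have eq: "rect_simplex l = f ` (convex hull (insert 0 Basis))"
    unfolding rect_simplex_def using convex_hull_linear_image[OF lin] by metis
  have std: "y \<in> convex hull (insert 0 Basis) \<longleftrightarrow> (\<forall>i. 0 \<le> y $ i) \<and> (\<Sum>i\<in>UNIV. y $ i) \<le> 1"
    for y :: "real ^ 'n"
  proof -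
    have "(\<Sum>i\<in>Basis. y \<bullet> i) = (\<Sum>i\<in>UNIV. y $ i)"
      unfolding Basis by (subst sum.reindex) (auto simp: inj_on_def axis_eq_axis inner_axis)
    moreover have "(\<forall>i\<in>Basis. 0 \<le> y \<bullet> i) \<longleftrightarrow> (\<forall>i. 0 \<le> y $ i)"
      by (simp add: Basis inner_axis)
    ultimately show ?thesis
      by (simp add: std_simplex)
  qed
  have "x \<in> rect_simplex l \<longleftrightarrow> (\<chi> i. x $ i / real (l $ i)) \<in> convex hull (insert 0 Basis)"
  proof
    assume "x \<in> rect_simplex l"
    then obtain y where "y \<in> convex hull (insert 0 Basis)" "x = f y"
      using eq by auto
    moreover have "(\<chi> i. f y $ i / real (l $ i)) = y"
      using l by (auto simp: f_def vec_eq_iff)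
    ultimately show "(\<chi> i. x $ i / real (l $ i)) \<in> convex hull (insert 0 Basis)"
      by simp
  next
    assume *: "(\<chi> i. x $ i / real (l $ i)) \<in> convex hull (insert 0 Basis)"
    have "x = f (\<chi> i. x $ i / real (l $ i))"
      using l by (auto simp: f_def vec_eq_iff)
    then show "x \<in> rect_simplex l"
      using * eq by blast
  qed
  moreover have "0 \<le> x $ i / real (l $ i) \<longleftrightarrow> 0 \<le> x $ i" for i
    using l[of i] by (simp add: zero_le_divide_iff)
  ultimately show ?thesis
    by (simp add: std)
qed

lemma mem_dilate_iff:
  assumes "0 < k"
  shows "x \<in> dilate k Q \<longleftrightarrow> (1 / real k) *\<^sub>R x \<in> Q"
proof -
  have "x = real k *\<^sub>R (1 / real k) *\<^sub>R x"
    using assms by simp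
  then have "x \<in> dilate k Q" if "(1 / real k) *\<^sub>R x \<in> Q"
    using that unfolding dilate_def by blast
  then show ?thesis
    using assms unfolding dilate_def by auto
qed

lemma dilate_dilate: "dilate m (dilate k Q) = dilate (m * k) Q"
  by (simp add: dilate_def image_image)

lemma mem_dilate_rect_simplex_iff:
  fixes l :: "nat ^ 'n"
  assumes l: "\<And>i. 0 < l $ i" and k: "0 < k"
  shows "x \<in> dilate k (rect_simplex l) \<longleftrightarrow>
    (\<forall>i. 0 \<le> x $ i) \<and> (\<Sum>i\<in>UNIV. x $ i / real (l $ i)) \<le> real k"
proof -
  have "(\<Sum>i\<in>UNIV. x $ i / (real k * real (l $ i))) = (\<Sum>i\<in>UNIV. x $ i / real (l $ i)) / real k"
    by (simp add: sum_divide_distrib mult.commute)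
  then show ?thesis
    using k by (simp add: mem_dilate_iff mem_rect_simplex_iff[OF l] zero_le_divide_iff)
qed

lemma lattice_polytope_dilate:
  assumes "lattice_polytope Q"
  shows "lattice_polytope (dilate k Q)"
proof -
  from assms obtain V where V: "finite V" "V \<subseteq> lattice_points" "Q = convex hull V"
    by (auto simp: lattice_polytope_def)
  then have "dilate k Q = convex hull ((\<lambda>x. real k *\<^sub>R x) ` V)"
    by (simp add: dilate_def convex_hull_scaling)
  moreover have "(\<lambda>x. real k *\<^sub>R x) ` V \<subseteq> lattice_points"
    using V(2) by (auto simp: lattice_points_def)
  ultimately show ?thesis
    using V(1) unfolding lattice_polytope_def by blast
qed

lemma lattice_polytope_rect_simplex: "lattice_polytope (rect_simplex l)"
proof -
  have "insert 0 (range (\<lambda>i. real (l $ i) *\<^sub>R axis i 1)) \<subseteq> lattice_points"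
    by (auto simp: lattice_points_def axis_def)
  then show ?thesis
    unfolding lattice_polytope_def rect_simplex_def by (metis finite finite_imageI finite_insert)
qed

lemma lattice_point_nonneg_obtain_nat:
  fixes x :: "real ^ 'n"
  assumes "x \<in> lattice_points" "\<And>i. 0 \<le> x $ i"
  obtains X :: "'n \<Rightarrow> nat" where "x = (\<chi> i. real (X i))"
proof
  show "x = (\<chi> i. real (nat \<lfloor>x $ i\<rfloor>))"
    using assms by (auto simp: lattice_points_def vec_eq_iff elim!: Ints_cases)
qed

section \<open>Normality of the k-th dilate for k \<ge> n - 1\<close>

text \<open>Serves to pick exactly \<open>k\<close> full blocks when coordinate \<open>i\<close>
  offers \<open>q i\<close> of them.\<close>

lemma exists_le_sum_eq:
  fixes q :: "'n::finite \<Rightarrow> nat"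
  assumes "k \<le> sum q UNIV"
  shows "\<exists>c. (\<forall>i. c i \<le> q i) \<and> sum c UNIV = k"
  using assms
proof (induction k)
  case 0
  show ?case by (intro exI[of _ "\<lambda>_. 0"]) simp
next
  case (Suc k)
  then obtain c where c: "\<forall>i. c i \<le> q i" "sum c UNIV = k" by auto
  with Suc.prems have "\<not> (\<forall>i. q i \<le> c i)"
    using sum_mono[of UNIV q c] by fastforce
  then obtain j where j: "c j < q j" by (auto simp: not_le)
  have "sum (c(j := Suc (c j))) UNIV = Suc k"
    using c(2) by (simp add: sum.remove[of UNIV j])
  then show ?case
    using c(1) j by (intro exI[of _ "c(j := Suc (c j))"]) auto
qed

text \<open>Measuring the weight of \<open>X\<close> by \<open>\<Sum>i. X i / l i\<close>, cut each coordinate into full blocks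
  of length \<open>l i\<close>, each of weight 1, and one remainder of weight below 1. Taking \<open>k\<close> of these
  pieces, full ones first, leaves either the exact difference or at most \<open>n - 1\<close> remainders.\<close>

lemma split_off_summand:
  fixes l X :: "'n::finite \<Rightarrow> nat"
  assumes l: "\<And>i. 0 < l i" and n: "CARD('n) \<le> k + 1" and m: "1 \<le> m"
    and X: "(\<Sum>i\<in>UNIV. real (X i) / real (l i)) \<le> real (Suc m * k)"
  shows "\<exists>Y. (\<forall>i. Y i \<le> X i) \<and> (\<Sum>i\<in>UNIV. real (Y i) / real (l i)) \<le> real k \<and>
    (\<Sum>i\<in>UNIV. real (X i - Y i) / real (l i)) \<le> real (m * k)"
proof (cases "k \<le> (\<Sum>i\<in>UNIV. X i div l i)")
  case True
  then obtain c where c: "\<And>i. c i \<le> X i div l i" "sum c UNIV = k"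
    using exists_le_sum_eq by blast
  define Y where "Y = (\<lambda>i. l i * c i)"
  have Y: "Y i \<le> X i" for i
    unfolding Y_def using c(1)[of i] by (meson le_trans mult_le_mono2 times_div_less_eq_dividend)
  have "real (Y i) / real (l i) = real (c i)" for i
    using l[of i] by (simp add: Y_def)
  then have wY: "(\<Sum>i\<in>UNIV. real (Y i) / real (l i)) = real k"
    using c(2) by (metis (mono_tags, lifting) of_nat_sum sum.cong)
  have "(\<Sum>i\<in>UNIV. real (X i - Y i) / real (l i)) =
      (\<Sum>i\<in>UNIV. real (X i) / real (l i)) - (\<Sum>i\<in>UNIV. real (Y i) / real (l i))"
    using Y by (simp add: of_nat_diff diff_divide_distrib sum_subtractf)
  also have "\<dots> \<le> real (m * k)"
    using X wY by (simp add: algebra_simps)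
  finally show ?thesis
    using Y wY by (intro exI[of _ Y]) simp
next
  case False
  define Q where "Q = (\<Sum>i\<in>UNIV. X i div l i)"
  have Q: "Q < k" using False by (simp add: Q_def)
  \<comment> \<open>All \<open>Q\<close> full blocks are taken; \<open>S\<close> marks the
    coordinates whose remainder is taken too, and \<open>min\<close> covers the case that there are
    fewer than \<open>k - Q\<close> coordinates.\<close>
  obtain S :: "'n set" where S: "card S = min (CARD('n)) (k - Q)"
    using obtain_subset_with_card_n[of "min (CARD('n)) (k - Q)" "UNIV :: 'n set"] by auto
  define Y where "Y = (\<lambda>i. if i \<in> S then X i else l i * (X i div l i))"
  have rem: "real (X i) / real (l i) = real (X i div l i) + real (X i mod l i) / real (l i)"
    and rem_le: "real (X i mod l i) / real (l i) \<le> 1" for i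
  proof -
    have "real (X i) = real (l i) * real (X i div l i) + real (X i mod l i)"
      by (metis mult_div_mod_eq of_nat_add of_nat_mult)
    then show "real (X i) / real (l i) = real (X i div l i) + real (X i mod l i) / real (l i)"
      using l[of i] by (simp add: field_simps)
    show "real (X i mod l i) / real (l i) \<le> 1"
      using l[of i] by (simp add: less_imp_le)
  qed
  have "real (Y i) / real (l i) \<le> real (X i div l i) + (if i \<in> S then 1 else 0)" for i
    using l[of i] rem[of i] rem_le[of i] by (simp add: Y_def)
  then have "(\<Sum>i\<in>UNIV. real (Y i) / real (l i)) \<le>
      (\<Sum>i\<in>UNIV. real (X i div l i) + (if i \<in> S then 1 else 0))"
    by (intro sum_mono)
  also have "\<dots> = real Q + real (card S)"
    by (simp add: sum.distrib Q_def sum.If_cases)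
  also have "\<dots> \<le> real k"
    using S Q by linarith
  finally have wY: "(\<Sum>i\<in>UNIV. real (Y i) / real (l i)) \<le> real k" .
  have "real (X i - Y i) / real (l i) \<le> (if i \<in> S then 0 else 1)" for i
    using rem_le[of i] by (simp add: Y_def minus_mult_div_eq_mod del: of_nat_diff)
  then have "(\<Sum>i\<in>UNIV. real (X i - Y i) / real (l i)) \<le> (\<Sum>i\<in>UNIV. if i \<in> S then 0 else 1)"
    by (intro sum_mono)
  also have "\<dots> = real (CARD('n) - card S)"
    by (simp add: sum.If_cases Compl_eq_Diff_UNIV card_Diff_subset)
  \<comment> \<open>As \<open>Q < k\<close>, the set \<open>S\<close> is nonempty, so at most n - 1
    \<le> k remainders are left.\<close>
  also have "\<dots> \<le> real k"
    using S Q n by simp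
  also have "\<dots> \<le> real (m * k)"
    using m by (simp del: of_nat_mult)
  finally show ?thesis
    using wY by (intro exI[of _ Y]) (auto simp: Y_def)
qed

text \<open>Induction on \<open>m\<close>, each step peeling off one summand by
  \<open>split_off_summand\<close>. It starts at 1 because the split needs a remaining budget of at
  least \<open>k\<close>.\<close>

lemma decompose_into_summands:
  fixes l X :: "'n::finite \<Rightarrow> nat"
  assumes l: "\<And>i. 0 < l i" and n: "CARD('n) \<le> k + 1" and m: "1 \<le> m"
    and "(\<Sum>i\<in>UNIV. real (X i) / real (l i)) \<le> real (m * k)"
  shows "\<exists>q. (\<forall>j<m. (\<Sum>i\<in>UNIV. real (q j i) / real (l i)) \<le> real k) \<and> (\<forall>i. X i = (\<Sum>j<m. q j i))"
  using m assms(4)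
proof (induction m arbitrary: X rule: nat_induct_at_least)
  case base
  then show ?case by (intro exI[of _ "\<lambda>_. X"]) simp
next
  case (Suc m)
  obtain Y where Y: "\<And>i. Y i \<le> X i" "(\<Sum>i\<in>UNIV. real (Y i) / real (l i)) \<le> real k"
    "(\<Sum>i\<in>UNIV. real (X i - Y i) / real (l i)) \<le> real (m * k)"
    using split_off_summand[OF l n Suc.hyps Suc.prems] by blast
  obtain q where q: "\<And>j. j < m \<Longrightarrow> (\<Sum>i\<in>UNIV. real (q j i) / real (l i)) \<le> real k"
    "\<And>i. X i - Y i = (\<Sum>j<m. q j i)"
    using Suc.IH[OF Y(3)] by blast
  have "X i = (\<Sum>j<Suc m. (q(m := Y)) j i)" for i
    using q(2)[of i] Y(1)[of i] by simp
  moreover have "(\<Sum>i\<in>UNIV. real ((q(m := Y)) j i) / real (l i)) \<le> real k" if "j < Suc m" for j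
    using q(1)[of j] Y(2) that by (cases "j = m") auto
  ultimately show ?case by blast
qed

proposition normal_polytope_dilate_rect_simplex:
  fixes l :: "nat ^ 'n"
  assumes l: "\<And>i. 0 < l $ i" and k: "0 < k" "CARD('n) \<le> k + 1"
  shows "normal_polytope (dilate k (rect_simplex l))"
  unfolding normal_polytope_def
proof (intro conjI allI impI ballI)
  show "lattice_polytope (dilate k (rect_simplex l))"
    by (intro lattice_polytope_dilate lattice_polytope_rect_simplex)
next
  fix m :: nat and x
  assume m: "1 \<le> m" and x: "x \<in> dilate m (dilate k (rect_simplex l)) \<inter> lattice_points"
  then have "\<forall>i. 0 \<le> x $ i" and w: "(\<Sum>i\<in>UNIV. x $ i / real (l $ i)) \<le> real (m * k)"
    using k(1) by (auto simp: dilate_dilate mem_dilate_rect_simplex_iff[OF l])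
  with x obtain X where X: "x = (\<chi> i. real (X i))"
    using lattice_point_nonneg_obtain_nat by blast
  obtain q where q: "\<And>j. j < m \<Longrightarrow> (\<Sum>i\<in>UNIV. real (q j i) / real (l $ i)) \<le> real k"
    "\<And>i. X i = (\<Sum>j<m. q j i)"
    using decompose_into_summands[of "\<lambda>i. l $ i" k m X] l k(2) m w X by auto
  have "(\<chi> i. real (q j i)) \<in> dilate k (rect_simplex l) \<inter> lattice_points" if "j < m" for j
    using q(1)[OF that] k(1)
    by (auto simp: mem_dilate_rect_simplex_iff[OF l] lattice_points_def)
  moreover have "x = (\<Sum>j<m. \<chi> i. real (q j i))"
    using q(2) by (simp add: X vec_eq_iff)
  ultimately show "\<exists>q. (\<forall>j<m. q j \<in> dilate k (rect_simplex l) \<inter> lattice_points) \<and>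
      x = (\<Sum>j<m. q j)"
    by (intro exI[of _ "\<lambda>j. \<chi> i. real (q j i)"]) blast
qed

section \<open>Failure of normality for the third dilate\<close>

lemma exhaust_5: "x = 1 \<or> x = 2 \<or> x = 3 \<or> x = 4 \<or> x = 5" for x :: 5
proof (induct x)
  case (of_int z)
  then have "z = 0 \<or> z = 1 \<or> z = 2 \<or> z = 3 \<or> z = 4" by (simp add: ac_simps) arith
  then show ?case by auto
qed

lemma UNIV_5: "UNIV = {1, 2, 3, 4, 5 :: 5}"
  using exhaust_5 by auto

lemma sum_5: "sum f (UNIV :: 5 set) = f 1 + f 2 + f 3 + f 4 + f 5"
  unfolding UNIV_5 by (simp add: ac_simps)

lemma forall_5: "(\<forall>i::5. P i) \<longleftrightarrow> P 1 \<and> P 2 \<and> P 3 \<and> P 4 \<and> P 5"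
  by (metis exhaust_5)

text \<open>After clearing the denominators, \<open>476630 = lcm (2, 5, 7, 11, 619)\<close> has weight 1. Modulo each
  \<open>\<lambda>\<^sub>i\<close> every other coefficient vanishes, so \<open>y\<^sub>i\<close> is a multiple of \<open>\<lambda>\<^sub>i\<close>;
  the bounds then leave only \<open>y\<^sub>1\<close>, which contributes weight at most \<open>5 / 2\<close>.\<close>

lemma no_weight_3:
  fixes y1 y2 y3 y4 y5 :: int
  assumes ge: "0 \<le> y1" "0 \<le> y2" "0 \<le> y3" "0 \<le> y4" "0 \<le> y5"
    and le: "y1 \<le> 5" "y2 \<le> 4" "y3 \<le> 6" "y4 \<le> 10" "y5 \<le> 578"
  shows "238315 * y1 + 95326 * y2 + 68090 * y3 + 43330 * y4 + 770 * y5 \<noteq> 3 * 476630"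
proof
  assume eq: "238315 * y1 + 95326 * y2 + 68090 * y3 + 43330 * y4 + 770 * y5 = 3 * 476630"
  have zero: "y = 0" if "y = m * k" "0 \<le> y" "y < m" for y m k :: int
    using that zdvd_not_zless[of y m] by (auto simp: le_less)
  \<comment> \<open>The coefficients of \<open>y2\<close>, \<open>y3\<close>, \<open>y4\<close> are
    1 modulo 5, 7, 11 respectively, so each variable can be isolated directly.\<close>
  have y: "y2 = 5 * (285978 - 47663 * y1 - 19065 * y2 - 13618 * y3 - 8666 * y4 - 154 * y5)"
    "y3 = 7 * (204270 - 34045 * y1 - 13618 * y2 - 9727 * y3 - 6190 * y4 - 110 * y5)"
    "y4 = 11 * (129990 - 21665 * y1 - 8666 * y2 - 6190 * y3 - 3939 * y4 - 70 * y5)"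
    using eq by - algebra+
  have 0: "y2 = 0" "y3 = 0" "y4 = 0"
    using ge le by - (rule zero[OF y(1)] zero[OF y(2)] zero[OF y(3)]; linarith)+
  \<comment> \<open>Here 41 inverts 770 modulo 619: \<open>41 * 770 = 51 * 619 + 1\<close>.\<close>
  have y5: "y5 = 619 * (41 * (2310 - 385 * y1) - 51 * y5)"
    using eq 0 by algebra
  have "y5 = 0"
    using ge le by (intro zero[OF y5]) linarith+
  then show False
    using eq 0 le by linarith
qed

text \<open>The residues \<open>(1, 4, 6, 10, 578)\<close> have weight exactly \<open>4 - 1 / 476630\<close>, so the point \<open>x\<close> below
  has weight \<open>6 - 1 / 476630\<close>: one of two summands of weight at most 3 would have weight exactly 3.\<close>

lemma not_normal_polytope_dilate_3:
  "\<not> normal_polytope (dilate 3 (rect_simplex (vector [2, 5, 7, 11, 619] :: nat ^ 5)))"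
proof
  let ?l = "vector [2, 5, 7, 11, 619] :: nat ^ 5"
  let ?D = "dilate 3 (rect_simplex ?l)"
  assume normal: "normal_polytope ?D"
  have l: "0 < ?l $ i" for i
    using forall_5[of "\<lambda>i. 0 < ?l $ i"] by simp
  \<comment> \<open>\<open>w\<close> is the weight times 476630, hence integral: two values below
    \<open>3 * 476630\<close> would sum to at most \<open>2 * (3 * 476630) - 2\<close>.\<close>
  define w :: "int ^ 5 \<Rightarrow> int" where
    "w Y = 238315 * Y $ 1 + 95326 * Y $ 2 + 68090 * Y $ 3 + 43330 * Y $ 4 + 770 * Y $ 5" for Y
  \<comment> \<open>The first entry is the residue 1 plus two full blocks of length 2, which lift
    the weight by 2.\<close>
  define X :: "int ^ 5" where "X = vector [5, 4, 6, 10, 578]"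
  define x :: "real ^ 5" where "x = (\<chi> i. real_of_int (X $ i))"
  have "x \<in> lattice_points"
    by (simp add: x_def lattice_points_def)
  moreover have "x \<in> dilate 2 ?D"
    by (simp add: dilate_dilate mem_dilate_rect_simplex_iff[OF l] forall_5 sum_5 x_def X_def)
  ultimately obtain q :: "nat \<Rightarrow> real ^ 5"
    where q: "\<And>j. j < 2 \<Longrightarrow> q j \<in> ?D \<inter> lattice_points"
    and sum: "x = (\<Sum>j<2. q j)"
    using normal[unfolded normal_polytope_def, THEN conjunct2, rule_format, of 2 x] by auto
  have "\<exists>Y. q j = (\<chi> i. real_of_int (Y $ i)) \<and> (\<forall>i. 0 \<le> Y $ i) \<and> w Y \<le> 3 * 476630"
    if "j < 2" for j
  proof -
    define Y :: "int ^ 5" where "Y = (\<chi> i. \<lfloor>q j $ i\<rfloor>)"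
    have Y: "q j = (\<chi> i. real_of_int (Y $ i))"
      using q[OF that] by (auto simp: Y_def vec_eq_iff lattice_points_def elim!: Ints_cases)
    have mem: "(\<forall>i. 0 \<le> q j $ i) \<and> (\<Sum>i\<in>UNIV. q j $ i / real (?l $ i)) \<le> real 3"
      using q[OF that] by (subst (asm) Int_iff, subst (asm) mem_dilate_rect_simplex_iff[OF l]) auto
    then have "real_of_int (w Y) \<le> real_of_int (3 * 476630)"
      by (simp add: sum_5 Y w_def)
    then show ?thesis
      using Y mem unfolding of_int_le_iff by (intro exI[of _ Y]) simp
  qed
  then obtain Y Z where Y: "q 0 = (\<chi> i. real_of_int (Y $ i))" "\<forall>i. 0 \<le> Y $ i"
      "w Y \<le> 3 * 476630"
    and Z: "q 1 = (\<chi> i. real_of_int (Z $ i))" "\<forall>i. 0 \<le> Z $ i"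
      "w Z \<le> 3 * 476630"
    by (metis one_less_numeral_iff pos2 semiring_norm(76))
  have "X $ i = Y $ i + Z $ i" for i
  proof -
    have "x $ i = q 0 $ i + q 1 $ i"
      by (simp add: sum lessThan_Suc numeral_2_eq_2)
    then have "real_of_int (X $ i) = real_of_int (Y $ i + Z $ i)"
      unfolding Y(1) Z(1) by (simp add: x_def)
    then show ?thesis by (simp only: of_int_eq_iff)
  qed
  then have "Z $ i = X $ i - Y $ i" for i
    by simp
  from this[of 1] this[of 2] this[of 3] this[of 4] this[of 5]
  have Z': "Z $ 1 = 5 - Y $ 1" "Z $ 2 = 4 - Y $ 2" "Z $ 3 = 6 - Y $ 3" "Z $ 4 = 10 - Y $ 4"
      "Z $ 5 = 578 - Y $ 5"
    by (simp_all only: X_def vector_5)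
  \<comment> \<open>Nonnegativity of each summand bounds the other by \<open>X\<close>, giving the
    upper bounds that \<open>no_weight_3\<close> requires.\<close>
  have nonneg: "0 \<le> Y $ i" "0 \<le> Z $ i" for i
    using Y(2) Z(2) by auto
  note bounds = nonneg[of 1] nonneg[of 2] nonneg[of 3] nonneg[of 4] nonneg[of 5]
  have "w Y \<noteq> 3 * 476630"
    unfolding w_def using Z' bounds by (intro no_weight_3) linarith+
  moreover have "w Z \<noteq> 3 * 476630"
    unfolding w_def using Z' bounds by (intro no_weight_3) linarith+
  moreover have "w Y + w Z = 2 * (3 * 476630) - 1"
    unfolding w_def Z' by (simp add: algebra_simps)
  ultimately show False
    using Y(3) Z(3) by linarith
qed

theorem corollary4p5:
  shows "maximal_normality_index (vector [2, 5, 7, 11, 619] :: nat ^ 5) \<and>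
    normality_index (rect_simplex (vector [2, 5, 7, 11, 619] :: nat ^ 5)) = 4"
proof -
  let ?l = "vector [2, 5, 7, 11, 619] :: nat ^ 5"
  have l: "0 < ?l $ i" for i
    using forall_5[of "\<lambda>i. 0 < ?l $ i"] by simp
  have "normality_index (rect_simplex ?l) = 4"
    unfolding normality_index_def
  proof (rule Least_equality)
    show "1 \<le> (4 :: nat) \<and> (\<forall>k\<ge>4. normal_polytope (dilate k (rect_simplex ?l)))"
      using normal_polytope_dilate_rect_simplex[OF l] by simp
  next
    fix k0 :: nat
    assume "1 \<le> k0 \<and> (\<forall>k\<ge>k0. normal_polytope (dilate k (rect_simplex ?l)))"
    then show "4 \<le> k0"
      using not_normal_polytope_dilate_3 not_less_eq_eq[of 3 k0] by auto
  qed
  then show ?thesis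
    using l by (simp add: maximal_normality_index_def)
qed

end
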